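(* Let $M\in\mathbb{R}^{m\times d}$ with $m<d$ have linearly independent rows and let $\Omega\in\mathbb{R}^{p\times d}$. Let $N^T$ be any $d\times(d-m)$ matrix whose columns form a basis of $\operatorname{Null}(M)$, and let $\Lambda\subseteq\{1,\dots,p\}$, $|\Lambda|=\ell$, be a fixed cosupport such that the $\ell\times(d-m)$ matrix $\Omega_\Lambda N^T$ is of full rank $d-m$. If $$\sup_{x_\Lambda\in\mathbb{R}^d:\ \Omega_\Lambda x_\Lambda=0}\left\|(N\Omega_\Lambda^T)^\dagger N\Omega_{\Lambda^c}^T\operatorname{sign}(\Omega_{\Lambda^c}x_\Lambda)\right\|_\infty<1,\qquad(\ast)$$ then for every $x_0\in\mathbb{R}^d$ with cosupport $\Lambda$, the problem $\min_{x}\|\Omega x\|_1$ subject to $Mx=Mx_0$ has $x_0$ as its unique minimizer. Moreover, if $$\left\|(N\Omega_\Lambda^T)^\dagger N\Omega_{\Lambda^c}^T\right\|_{\infty\to\infty}=\left\|\Omega_{\Lambda^c}N^T(\Omega_\Lambda N^T)^\dagger\right\|_{1\to1}<1,$$ (where the equality of the two operator norms always holds), then condition $(\ast)$ holds.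
   Context: The cosupport of a vector $x\in\mathbb{R}^d$ with respect to $\Omega\in\mathbb{R}^{p\times d}$ is the index set of zero entries of $\Omega x$, i.e. $\{i:(\Omega x)_i=0\}$. "$\Lambda$ is a fixed cosupport" means that $\Lambda$ is the cosupport of some vector in $\mathbb{R}^d$. For an index set $\Lambda\subseteq\{1,\dots,p\}$, $\Omega_\Lambda$ is the submatrix of $\Omega$ consisting of the rows indexed by $\Lambda$, and $\Lambda^c$ is the complement of $\Lambda$ in $\{1,\dots,p\}$. $A^\dagger$ is the Moore–Penrose pseudo-inverse of $A$; $\|A\|_{q\to q}$ is the operator norm of $A$ induced by the $\ell_q$-norm on both sides. The function $\operatorname{sign}$ acts entrywise, with $\operatorname{sign}(0)=0$. *)

theory Defs
  imports
    Complex_Main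
    "Jordan_Normal_Form.Matrix_Kernel"
    "Jordan_Normal_Form.DL_Rank"
    "Jordan_Normal_Form.DL_Submatrix"
begin

(* Vectors and matrices carry their dimensions as natural numbers, so index sets
   {1..p} become {..<p}, and matrices with no rows or no columns are allowed (the
   complement of a cosupport may be empty). *)

definition cosupport :: "real mat \<Rightarrow> real vec \<Rightarrow> nat set" where
  "cosupport \<Omega> x = {i. i < dim_row \<Omega> \<and> (\<Omega> *\<^sub>v x) $ i = 0}"

abbreviation row_submatrix :: "'a mat \<Rightarrow> nat set \<Rightarrow> 'a mat" where
  "row_submatrix A I \<equiv> submatrix A I UNIV"

definition l1_norm :: "real vec \<Rightarrow> real" where
  "l1_norm v = (\<Sum>i<dim_vec v. \<bar>v $ i\<bar>)"

(* Inserting 0 only matters for vectors of length 0, whose norm is 0. *)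
definition linf_norm :: "real vec \<Rightarrow> real" where
  "linf_norm v = Max (insert 0 ((\<lambda>i. \<bar>v $ i\<bar>) ` {..<dim_vec v}))"

definition sign_vec :: "real vec \<Rightarrow> real vec" where
  "sign_vec v = map_vec sgn v"

(* The four Penrose equations; over the reals the adjoint is the transpose. *)
definition is_pseudo_inverse :: "real mat \<Rightarrow> real mat \<Rightarrow> bool" where
  "is_pseudo_inverse A X \<longleftrightarrow>
     X \<in> carrier_mat (dim_col A) (dim_row A) \<and>
     A * X * A = A \<and>
     X * A * X = X \<and>
     transpose_mat (A * X) = A * X \<and>
     transpose_mat (X * A) = X * A"

definition pseudo_inverse :: "real mat \<Rightarrow> real mat" where
  "pseudo_inverse A = (THE X. is_pseudo_inverse A X)"

(* The operator norm induced by the norm nrm on both sides. *)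
definition op_norm :: "(real vec \<Rightarrow> real) \<Rightarrow> real mat \<Rightarrow> real" where
  "op_norm nrm A = (SUP x\<in>{x \<in> carrier_vec (dim_col A). nrm x \<le> 1}. nrm (A *\<^sub>v x))"

definition unique_minimizer :: "('a \<Rightarrow> real) \<Rightarrow> ('a \<Rightarrow> bool) \<Rightarrow> 'a \<Rightarrow> bool" where
  "unique_minimizer f P x \<longleftrightarrow> (\<forall>y. is_arg_min f P y \<longleftrightarrow> y = x)"

(* Linear independence of the family of rows (hence no repeated row). *)
definition lin_indpt_rows :: "real mat \<Rightarrow> bool" where
  "lin_indpt_rows A \<longleftrightarrow>
     distinct (rows A) \<and>
     \<not> module.lin_dep class_ring (module_vec TYPE(real) (dim_col A)) (set (rows A))"

(* The columns of B, without repetition, are a basis of the null space of A. *)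
definition cols_basis_of_kernel :: "real mat \<Rightarrow> real mat \<Rightarrow> bool" where
  "cols_basis_of_kernel B A \<longleftrightarrow>
     distinct (cols B) \<and> kernel.basis (dim_col A) A (set (cols B))"

(* The supremum in the recovery condition ranges over a nonempty set of reals which is
   finite, since sign_vec takes finitely many values in each dimension; hence the
   real-valued SUP is the actual supremum. *)
definition recovery_condition :: "real mat \<Rightarrow> real mat \<Rightarrow> nat set \<Rightarrow> bool" where
  "recovery_condition \<Omega> N \<Lambda> \<longleftrightarrow>
     (let \<Omega>\<^sub>L = row_submatrix \<Omega> \<Lambda>; \<Omega>\<^sub>C = row_submatrix \<Omega> ({..<dim_row \<Omega>} - \<Lambda>) in
      (SUP x\<in>{x \<in> carrier_vec (dim_col \<Omega>). \<Omega>\<^sub>L *\<^sub>v x = 0\<^sub>v (dim_row \<Omega>\<^sub>L)}.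
         linf_norm ((pseudo_inverse (N * transpose_mat \<Omega>\<^sub>L) * (N * transpose_mat \<Omega>\<^sub>C))
                    *\<^sub>v sign_vec (\<Omega>\<^sub>C *\<^sub>v x))) < 1)"

end

theory Submission
  imports Defs
begin

text \<open>
  Write \<open>G = \<Omega>\<^sub>\<Lambda> N\<^sup>T\<close>, which has a left inverse \<open>G\<^sup>\<dagger>\<close>, and let \<open>C\<close> be the submatrix of
  the rows outside \<open>\<Lambda>\<close>. A competitor is \<open>x\<^sub>0 + z\<close> with \<open>z = N\<^sup>T w\<close> in the null space, and
  \<open>C z = (C N\<^sup>T G\<^sup>\<dagger>) \<Omega>\<^sub>\<Lambda> z\<close>. Hence, with \<open>s = sign (C x\<^sub>0)\<close>, the first-order change
  \<open>\<langle>s, C z\<rangle>\<close> of the norm off \<open>\<Lambda>\<close> equals \<open>\<langle>q, \<Omega>\<^sub>\<Lambda> z\<rangle>\<close>, where \<open>q\<close> is the vector bounded by the recovery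
  condition; since \<open>\<parallel>q\<parallel>\<^sub>\<infinity> < 1\<close> and \<open>\<Omega>\<^sub>\<Lambda> z \<noteq> 0\<close>, it is beaten by the growth \<open>\<parallel>\<Omega>\<^sub>\<Lambda> z\<parallel>\<^sub>1\<close> on \<open>\<Lambda>\<close>.
  The two operator norms belong to transposed matrices, hence agree by duality of the
  two vector norms.
\<close>

section \<open>Row submatrices and the l1-norm split along an index set\<close>

text \<open>\<open>pick I\<close> enumerates \<open>I\<close> in increasing order, and its inverse
  counts the members of \<open>I\<close> below a given one. This turns sums over positions in a
  submatrix into sums over the original row indices.\<close>

lemma sum_pick:
  assumes "finite I"
  shows "(\<Sum>k<card I. f (pick I k)) = (\<Sum>i\<in>I. f i)"
proof (rule sum.reindex_bij_witness[where i = "\<lambda>i. card {a \<in> I. a < i}" and j = "pick I"])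
  fix i assume i: "i \<in> I"
  show "pick I (card {a \<in> I. a < i}) = i" using i by (rule pick_card_in_set)
  have "{a \<in> I. a < i} \<subset> I" using i by auto
  then show "card {a \<in> I. a < i} \<in> {..<card I}"
    using assms by (simp add: psubset_card_mono)
next
  fix k assume "k \<in> {..<card I}"
  then have k: "k < card I \<or> infinite I" by simp
  show "card {a \<in> I. a < pick I k} = k" by (rule card_pick[OF k])
  show "pick I k \<in> I" by (rule pick_in_set[OF k])
qed (rule refl)

lemma row_submatrix_carrier:
  assumes "A \<in> carrier_mat p d" "I \<subseteq> {..<p}"
  shows "row_submatrix A I \<in> carrier_mat (card I) d"
proof -
  have "{i. i < p \<and> i \<in> I} = I" using assms(2) by auto
  then show ?thesis using assms(1) unfolding carrier_mat_def by (simp add: dim_submatrix)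
qed

lemma index_row_submatrix_mult_vec:
  assumes A: "A \<in> carrier_mat p d" and I: "I \<subseteq> {..<p}" and k: "k < card I"
  shows "(row_submatrix A I *\<^sub>v x) $ k = (A *\<^sub>v x) $ (pick I k)"
proof -
  have eq: "{i. i < p \<and> i \<in> I} = I" using I by auto
  have p: "pick I k < p" using I pick_in_set[of k I] k by auto
  have "row (row_submatrix A I) k = row A (pick I k)"
    using A k p eq by (intro eq_vecI) (auto simp: dim_submatrix submatrix_index pick_UNIV)
  then show ?thesis using A k p eq by (simp add: dim_submatrix)
qed

lemma l1_norm_row_submatrix_mult_vec:
  assumes "A \<in> carrier_mat p d" "I \<subseteq> {..<p}"
  shows "l1_norm (row_submatrix A I *\<^sub>v x) = (\<Sum>i\<in>I. \<bar>(A *\<^sub>v x) $ i\<bar>)"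
proof -
  have dim: "dim_vec (row_submatrix A I *\<^sub>v x) = card I"
    using row_submatrix_carrier[OF assms] by simp
  have "l1_norm (row_submatrix A I *\<^sub>v x) = (\<Sum>k<card I. \<bar>(A *\<^sub>v x) $ pick I k\<bar>)"
    unfolding l1_norm_def dim
    by (rule sum.cong[OF refl]) (simp only: lessThan_iff index_row_submatrix_mult_vec[OF assms])
  also have "\<dots> = (\<Sum>i\<in>I. \<bar>(A *\<^sub>v x) $ i\<bar>)"
    by (rule sum_pick[OF finite_subset[OF assms(2) finite_lessThan]])
  finally show ?thesis .
qed

lemma l1_norm_split_rows:
  assumes A: "A \<in> carrier_mat p d" and I: "I \<subseteq> {..<p}"
  shows "l1_norm (A *\<^sub>v x) =
    l1_norm (row_submatrix A I *\<^sub>v x) + l1_norm (row_submatrix A ({..<p} - I) *\<^sub>v x)"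
proof -
  have dim: "dim_vec (A *\<^sub>v x) = p" using A by simp
  show ?thesis
    unfolding l1_norm_row_submatrix_mult_vec[OF A I] l1_norm_row_submatrix_mult_vec[OF A Diff_subset]
    unfolding l1_norm_def dim
    by (subst add.commute) (rule sum.subset_diff[OF I finite_lessThan])
qed

lemma row_submatrix_cosupport:
  assumes A: "A \<in> carrier_mat p d"
  shows "row_submatrix A (cosupport A x) *\<^sub>v x = 0\<^sub>v (card (cosupport A x))"
proof -
  have sub: "cosupport A x \<subseteq> {..<p}" using A by (auto simp: cosupport_def)
  show ?thesis
  proof (rule eq_vecI)
    show "dim_vec (row_submatrix A (cosupport A x) *\<^sub>v x) = dim_vec (0\<^sub>v (card (cosupport A x)))"
      using row_submatrix_carrier[OF A sub] by simp
    fix k assume "k < dim_vec (0\<^sub>v (card (cosupport A x)) :: real vec)"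
    then have k: "k < card (cosupport A x)" by simp
    have "pick (cosupport A x) k \<in> cosupport A x" using k by (simp add: pick_in_set)
    then have "(A *\<^sub>v x) $ pick (cosupport A x) k = 0" unfolding cosupport_def by blast
    then show "(row_submatrix A (cosupport A x) *\<^sub>v x) $ k = 0\<^sub>v (card (cosupport A x)) $ k"
      using k index_row_submatrix_mult_vec[OF A sub k] by (metis index_zero_vec(1))
  qed
qed

section \<open>The two dual vector norms and sign vectors\<close>

lemma l1_norm_nonneg: "0 \<le> l1_norm v"
  by (simp add: l1_norm_def sum_nonneg)

lemma l1_norm_pos:
  assumes "v \<in> carrier_vec n" "v \<noteq> 0\<^sub>v n"
  shows "0 < l1_norm v"
proof -
  obtain i where i: "i < n" "v $ i \<noteq> 0"
    using assms by (metis carrier_vecD eq_vecI index_zero_vec)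
  have "\<bar>v $ i\<bar> \<le> l1_norm v"
    unfolding l1_norm_def using assms(1) i by (intro member_le_sum) auto
  then show ?thesis using i by simp
qed

lemma abs_index_le_linf_norm: "i < dim_vec v \<Longrightarrow> \<bar>v $ i\<bar> \<le> linf_norm v"
  unfolding linf_norm_def by (intro Max_ge) auto

lemma linf_norm_nonneg: "0 \<le> linf_norm v"
  unfolding linf_norm_def by (intro Max_ge) auto

text \<open>The requirement \<open>0 \<le> c\<close> accounts for the inserted 0 in
  \<open>linf_norm\<close>, which is the whole norm of a vector of length 0.\<close>

lemma linf_norm_leI:
  assumes "0 \<le> c" "\<And>i. i < dim_vec v \<Longrightarrow> \<bar>v $ i\<bar> \<le> c"
  shows "linf_norm v \<le> c"
  unfolding linf_norm_def using assms by (subst Max_le_iff) auto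

lemma holder_l1_linf:
  assumes "u \<in> carrier_vec n" "v \<in> carrier_vec n"
  shows "\<bar>u \<bullet> v\<bar> \<le> linf_norm u * l1_norm v"
proof -
  have "\<bar>u \<bullet> v\<bar> \<le> (\<Sum>i<n. \<bar>u $ i * v $ i\<bar>)"
    using assms by (auto simp: scalar_prod_def lessThan_atLeast0)
  also have "\<dots> \<le> (\<Sum>i<n. linf_norm u * \<bar>v $ i\<bar>)"
    unfolding abs_mult using assms by (intro sum_mono mult_right_mono abs_index_le_linf_norm) auto
  finally show ?thesis using assms by (simp add: l1_norm_def sum_distrib_left)
qed

lemma sign_vec_carrier: "v \<in> carrier_vec n \<Longrightarrow> sign_vec v \<in> carrier_vec n"
  by (simp add: sign_vec_def)

lemma linf_norm_sign_vec_le: "linf_norm (sign_vec v) \<le> 1"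
  by (rule linf_norm_leI) (auto simp: sign_vec_def abs_sgn_eq)

lemma sign_vec_scalar_prod_self: "sign_vec v \<bullet> v = l1_norm v"
  unfolding scalar_prod_def sign_vec_def l1_norm_def lessThan_atLeast0
  by (intro sum.cong) (auto simp: abs_sgn mult.commute)

text \<open>Hoelder, since a sign vector lies in the unit ball of the maximum norm. Together with
  \<open>sign_vec_scalar_prod_self\<close> this makes \<open>sign_vec u\<close> a subgradient of the
  l1-norm at \<open>u\<close>.\<close>

lemma sign_vec_scalar_prod_le:
  assumes "u \<in> carrier_vec n" "v \<in> carrier_vec n"
  shows "sign_vec u \<bullet> v \<le> l1_norm v"
proof -
  have "sign_vec u \<bullet> v \<le> linf_norm (sign_vec u) * l1_norm v"
    using holder_l1_linf[OF sign_vec_carrier[OF assms(1)] assms(2)] by simp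
  also have "\<dots> \<le> 1 * l1_norm v"
    by (intro mult_right_mono linf_norm_sign_vec_le l1_norm_nonneg)
  finally show ?thesis by simp
qed

section \<open>Operator norms and their duality under transposition\<close>

text \<open>Hoelder bounds each entry by the l1-norm of its row, and the sum over all rows dominates
  each of them. The bound is crude, but being uniform in \<open>u\<close> it shows that the supremum
  in \<open>op_norm\<close> is over a bounded set.\<close>

lemma linf_norm_mult_vec_le:
  assumes A: "A \<in> carrier_mat n k" and u: "u \<in> carrier_vec k" "linf_norm u \<le> 1"
  shows "linf_norm (A *\<^sub>v u) \<le> (\<Sum>i<n. l1_norm (row A i))"
proof (rule linf_norm_leI)
  show "0 \<le> (\<Sum>i<n. l1_norm (row A i))" by (simp add: sum_nonneg l1_norm_nonneg)
  fix i assume "i < dim_vec (A *\<^sub>v u)"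
  then have i: "i < n" using A by simp
  have r: "row A i \<in> carrier_vec k" using A i by (auto intro: row_carrier_vec)
  have "\<bar>(A *\<^sub>v u) $ i\<bar> = \<bar>u \<bullet> row A i\<bar>"
    using A i comm_scalar_prod[OF r u(1)] by simp
  also have "\<dots> \<le> linf_norm u * l1_norm (row A i)" by (rule holder_l1_linf[OF u(1) r])
  also have "\<dots> \<le> l1_norm (row A i)" using u(2) l1_norm_nonneg by (simp add: mult_left_le_one_le linf_norm_nonneg)
  also have "\<dots> \<le> (\<Sum>i<n. l1_norm (row A i))"
    using i by (intro member_le_sum) (auto simp: l1_norm_nonneg)
  finally show "\<bar>(A *\<^sub>v u) $ i\<bar> \<le> (\<Sum>i<n. l1_norm (row A i))" .
qed

lemma linf_norm_mult_vec_le_op_norm: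
  assumes A: "A \<in> carrier_mat n k" and u: "u \<in> carrier_vec k" "linf_norm u \<le> 1"
  shows "linf_norm (A *\<^sub>v u) \<le> op_norm linf_norm A"
  unfolding op_norm_def
proof (rule cSUP_upper)
  show "u \<in> {x \<in> carrier_vec (dim_col A). linf_norm x \<le> 1}" using A u by auto
  show "bdd_above ((\<lambda>x. linf_norm (A *\<^sub>v x)) ` {x \<in> carrier_vec (dim_col A). linf_norm x \<le> 1})"
    using A linf_norm_mult_vec_le[OF A] by (auto intro!: bdd_aboveI2)
qed

text \<open>Testing \<open>A\<^sup>T v\<close> against its own sign vector moves \<open>A\<close> to the other factor.\<close>

lemma l1_norm_transpose_mult_vec_le:
  assumes A: "A \<in> carrier_mat n k" and v: "v \<in> carrier_vec n" "l1_norm v \<le> 1"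
  shows "l1_norm (transpose_mat A *\<^sub>v v) \<le> op_norm linf_norm A"
proof -
  let ?w = "transpose_mat A *\<^sub>v v"
  have w: "?w \<in> carrier_vec k" using A v by auto
  have s: "sign_vec ?w \<in> carrier_vec k" by (rule sign_vec_carrier[OF w])
  have As: "A *\<^sub>v sign_vec ?w \<in> carrier_vec n" using A s by auto
  have "l1_norm ?w = ?w \<bullet> sign_vec ?w"
    using sign_vec_scalar_prod_self[of ?w] comm_scalar_prod[OF w s] by simp
  also have "\<dots> = v \<bullet> (A *\<^sub>v sign_vec ?w)" by (rule transpose_vec_mult_scalar[OF A s v(1)])
  also have "\<dots> = (A *\<^sub>v sign_vec ?w) \<bullet> v" by (rule comm_scalar_prod[OF v(1) As])
  also have "\<dots> \<le> linf_norm (A *\<^sub>v sign_vec ?w) * l1_norm v"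
    using holder_l1_linf[OF As v(1)] by simp
  also have "\<dots> \<le> linf_norm (A *\<^sub>v sign_vec ?w)"
    using v(2) by (simp add: mult_left_le linf_norm_nonneg)
  also have "\<dots> \<le> op_norm linf_norm A"
    by (rule linf_norm_mult_vec_le_op_norm[OF A s linf_norm_sign_vec_le])
  finally show ?thesis .
qed

lemma l1_norm_unit_vec: "i < n \<Longrightarrow> l1_norm (unit_vec n i) = 1"
proof -
  assume i: "i < n"
  have "l1_norm (unit_vec n i) = (\<Sum>j<n. if j = i then 1 else 0)"
    unfolding l1_norm_def using i by (intro sum.cong) auto
  then show ?thesis using i by simp
qed

text \<open>One inequality is the sign-vector test above. For the other, entry \<open>i\<close> of
  \<open>A *\<^sub>v u\<close> pairs \<open>u\<close> with the image of the \<open>i\<close>-th unit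
  vector under the transpose, and unit vectors lie in the l1 unit ball.\<close>

lemma op_norm_linf_eq_op_norm_l1_transpose:
  assumes A: "A \<in> carrier_mat n k"
  shows "op_norm linf_norm A = op_norm l1_norm (transpose_mat A)"
proof (rule antisym)
  have zero: "linf_norm (0\<^sub>v k) \<le> 1" "l1_norm (0\<^sub>v n) \<le> 1"
    by (auto intro: linf_norm_leI simp: l1_norm_def)
  \<comment> \<open>The boundedness required of this supremum comes from the opposite inequality,
    which bounds every value by \<open>op_norm linf_norm A\<close>.\<close>
  have le: "l1_norm (transpose_mat A *\<^sub>v v) \<le> op_norm l1_norm (transpose_mat A)"
    if v: "v \<in> carrier_vec n" "l1_norm v \<le> 1" for v
    unfolding op_norm_def
  proof (rule cSUP_upper)
    show "v \<in> {x \<in> carrier_vec (dim_col (transpose_mat A)). l1_norm x \<le> 1}" using A v by auto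
    show "bdd_above ((\<lambda>x. l1_norm (transpose_mat A *\<^sub>v x)) `
        {x \<in> carrier_vec (dim_col (transpose_mat A)). l1_norm x \<le> 1})"
      using A l1_norm_transpose_mult_vec_le[OF A] by (auto intro!: bdd_aboveI2)
  qed
  show "op_norm l1_norm (transpose_mat A) \<le> op_norm linf_norm A"
    unfolding op_norm_def[of l1_norm]
  proof (rule cSUP_least)
    show "{x \<in> carrier_vec (dim_col (transpose_mat A)). l1_norm x \<le> 1} \<noteq> {}"
      using A zero(2) by (auto intro!: exI[of _ "0\<^sub>v n"])
  qed (use A l1_norm_transpose_mult_vec_le[OF A] in auto)
  show "op_norm linf_norm A \<le> op_norm l1_norm (transpose_mat A)"
    unfolding op_norm_def[of linf_norm]
  proof (rule cSUP_least)
    show "{x \<in> carrier_vec (dim_col A). linf_norm x \<le> 1} \<noteq> {}"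
      using A zero(1) by (auto intro!: exI[of _ "0\<^sub>v k"])
    fix u assume "u \<in> {x \<in> carrier_vec (dim_col A). linf_norm x \<le> 1}"
    then have u: "u \<in> carrier_vec k" "linf_norm u \<le> 1" using A by auto
    show "linf_norm (A *\<^sub>v u) \<le> op_norm l1_norm (transpose_mat A)"
    proof (rule linf_norm_leI)
      \<comment> \<open>The value at the zero vector keeps the bound nonnegative, even when
        \<open>A\<close> has no rows.\<close>
      show "0 \<le> op_norm l1_norm (transpose_mat A)"
        using order_trans[OF l1_norm_nonneg le[of "0\<^sub>v n"]] zero(2) by simp
      fix i assume "i < dim_vec (A *\<^sub>v u)"
      then have i: "i < n" using A by simp
      let ?r = "transpose_mat A *\<^sub>v unit_vec n i"
      have r: "?r \<in> carrier_vec k" using A by auto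
      have "(A *\<^sub>v u) $ i = unit_vec n i \<bullet> (A *\<^sub>v u)"
        using A u(1) i by (intro scalar_prod_left_unit[symmetric]) auto
      also have "\<dots> = ?r \<bullet> u"
        by (rule transpose_vec_mult_scalar[OF A u(1) unit_vec_carrier, symmetric])
      also have "\<dots> = u \<bullet> ?r" by (rule comm_scalar_prod[OF r u(1)])
      finally have "\<bar>(A *\<^sub>v u) $ i\<bar> \<le> linf_norm u * l1_norm ?r"
        using holder_l1_linf[OF u(1) r] by simp
      also have "\<dots> \<le> l1_norm ?r"
        using u(2) by (simp add: mult_left_le_one_le linf_norm_nonneg l1_norm_nonneg)
      also have "\<dots> \<le> op_norm l1_norm (transpose_mat A)"
        by (rule le) (use i in \<open>auto simp: l1_norm_unit_vec\<close>)
      finally show "\<bar>(A *\<^sub>v u) $ i\<bar> \<le> op_norm l1_norm (transpose_mat A)" .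
    qed
  qed
qed

section \<open>The Moore-Penrose pseudo-inverse\<close>

text \<open>The symmetry equations allow products to be reversed by transposing, which gives
  \<open>A * X = A * Y\<close> and \<open>X * A = Y * A\<close>; then X = XAX = YAX = YAY = Y.
  Uniqueness gives access to the definite description in \<open>pseudo_inverse\<close>.\<close>

lemma is_pseudo_inverse_unique:
  assumes X: "is_pseudo_inverse A X" and Y: "is_pseudo_inverse A Y"
  shows "X = Y"
proof -
  obtain n k where A: "A \<in> carrier_mat n k" by auto
  have Xc: "X \<in> carrier_mat k n" and Yc: "Y \<in> carrier_mat k n"
    using X Y A by (auto simp: is_pseudo_inverse_def)
  have AX: "A * X \<in> carrier_mat n n" and AY: "A * Y \<in> carrier_mat n n"
    and XA: "X * A \<in> carrier_mat k k" and YA: "Y * A \<in> carrier_mat k k" 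
    using A Xc Yc by auto
  have "A * X = (A * Y * A) * X" using Y by (simp add: is_pseudo_inverse_def)
  also have "\<dots> = (A * Y) * (A * X)" using AY A Xc by (rule assoc_mult_mat)
  also have "\<dots> = transpose_mat (A * Y) * transpose_mat (A * X)"
    using X Y by (simp add: is_pseudo_inverse_def)
  also have "\<dots> = transpose_mat ((A * X) * (A * Y))"
    by (rule transpose_mult[OF AX AY, symmetric])
  also have "(A * X) * (A * Y) = (A * X * A) * Y" by (rule assoc_mult_mat[OF AX A Yc, symmetric])
  also have "transpose_mat \<dots> = A * Y" using X Y by (simp add: is_pseudo_inverse_def)
  finally have eq1: "A * X = A * Y" .
  have "X * A = X * (A * Y * A)" using Y by (simp add: is_pseudo_inverse_def)
  also have "\<dots> = (X * A) * (Y * A)" 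
    using assoc_mult_mat[OF Xc A YA] assoc_mult_mat[OF A Yc A] by simp
  also have "\<dots> = transpose_mat (X * A) * transpose_mat (Y * A)"
    using X Y by (simp add: is_pseudo_inverse_def)
  also have "\<dots> = transpose_mat ((Y * A) * (X * A))"
    by (rule transpose_mult[OF YA XA, symmetric])
  also have "(Y * A) * (X * A) = Y * (A * X * A)"
    using assoc_mult_mat[OF Yc A XA] assoc_mult_mat[OF A Xc A] by simp
  also have "transpose_mat \<dots> = Y * A" using X Y by (simp add: is_pseudo_inverse_def)
  finally have eq2: "X * A = Y * A" .
  have "X = X * A * X" using X by (simp add: is_pseudo_inverse_def)
  also have "\<dots> = Y * A * X" using eq2 by simp
  also have "\<dots> = Y * (A * X)" by (rule assoc_mult_mat[OF Yc A Xc])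
  also have "\<dots> = Y * (A * Y)" using eq1 by simp
  also have "\<dots> = Y * A * Y" by (rule assoc_mult_mat[OF Yc A Yc, symmetric])
  also have "\<dots> = Y" using Y by (simp add: is_pseudo_inverse_def)
  finally show ?thesis .
qed

lemma pseudo_inverse_eqI: "is_pseudo_inverse A X \<Longrightarrow> pseudo_inverse A = X"
  unfolding pseudo_inverse_def by (blast intro: the_equality is_pseudo_inverse_unique)

text \<open>Transposition exchanges the two symmetry equations and preserves the other two. This
  relates the two pseudo-inverses that occur in the two operator norms.\<close>

lemma is_pseudo_inverse_transpose:
  assumes X: "is_pseudo_inverse A X"
  shows "is_pseudo_inverse (transpose_mat A) (transpose_mat X)"
proof -
  obtain n k where A: "A \<in> carrier_mat n k" by auto
  have Xc: "X \<in> carrier_mat k n" using X A by (auto simp: is_pseudo_inverse_def)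
  have AX: "A * X \<in> carrier_mat n n" and XA: "X * A \<in> carrier_mat k k" using A Xc by auto
  have 1: "transpose_mat A * transpose_mat X = transpose_mat (X * A)"
    by (rule transpose_mult[OF Xc A, symmetric])
  have 2: "transpose_mat X * transpose_mat A = transpose_mat (A * X)"
    by (rule transpose_mult[OF A Xc, symmetric])
  have 3: "transpose_mat (X * A) * transpose_mat A = transpose_mat (A * X * A)"
    using transpose_mult[OF A XA] assoc_mult_mat[OF A Xc A] by simp
  have 4: "transpose_mat (A * X) * transpose_mat X = transpose_mat (X * A * X)"
    using transpose_mult[OF Xc AX] assoc_mult_mat[OF Xc A Xc] by simp
  show ?thesis
    using X A Xc unfolding is_pseudo_inverse_def 1 2 3 4 by auto
qed

lemma scalar_prod_self_eq_0_real:
  fixes v :: "real vec"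
  assumes "v \<in> carrier_vec n" "v \<bullet> v = 0"
  shows "v = 0\<^sub>v n"
proof (rule eq_vecI)
  fix i assume "i < dim_vec (0\<^sub>v n :: real vec)"
  then show "v $ i = 0\<^sub>v n $ i"
    using assms sum_nonneg_eq_0_iff[of "{0..<n}" "\<lambda>i. v $ i * v $ i"]
    by (auto simp: scalar_prod_def)
qed (use assms in auto)

text \<open>With trivial kernel, the Gram matrix \<open>G\<^sup>T G\<close> is invertible and the
  pseudo-inverse is \<open>(G\<^sup>T G)\<^sup>-\<^sup>1 G\<^sup>T\<close>.\<close>

lemma pseudo_inverse_trivial_kernel:
  assumes G: "G \<in> carrier_mat l k"
    and inj: "\<And>w. w \<in> carrier_vec k \<Longrightarrow> G *\<^sub>v w = 0\<^sub>v l \<Longrightarrow> w = 0\<^sub>v k"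
  shows "is_pseudo_inverse G (pseudo_inverse G)" and "pseudo_inverse G * G = 1\<^sub>m k"
proof -
  let ?T = "transpose_mat G"
  let ?K = "?T * G"
  have T: "?T \<in> carrier_mat k l" and K: "?K \<in> carrier_mat k k" using G by auto
  \<comment> \<open>If \<open>?K\<close> annihilates \<open>w\<close>, moving the transpose across
    the scalar product gives <Gw, Gw> = <Kw, w> = 0, so \<open>w\<close> is in the trivial kernel of
    \<open>G\<close>.\<close>
  have "det ?K \<noteq> 0"
  proof
    assume "det ?K = 0"
    then obtain w where w: "w \<in> carrier_vec k" "w \<noteq> 0\<^sub>v k" "?K *\<^sub>v w = 0\<^sub>v k"
      using det_0_iff_vec_prod_zero[OF K] by auto
    have Gw: "G *\<^sub>v w \<in> carrier_vec l" using G w by auto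
    have "(G *\<^sub>v w) \<bullet> (G *\<^sub>v w) = (?T *\<^sub>v (G *\<^sub>v w)) \<bullet> w"
      by (rule transpose_vec_mult_scalar[OF G w(1) Gw, symmetric])
    also have "?T *\<^sub>v (G *\<^sub>v w) = 0\<^sub>v k" using assoc_mult_mat_vec[OF T G w(1)] w(3) by simp
    finally have "(G *\<^sub>v w) \<bullet> (G *\<^sub>v w) = 0" using w(1) by simp
    then show False using scalar_prod_self_eq_0_real[OF Gw] inj w by blast
  qed
  from det_non_zero_imp_unit[OF K this, of "()"]
  obtain H where H: "H \<in> carrier_mat k k" "H * ?K = 1\<^sub>m k" "?K * H = 1\<^sub>m k"
    by (auto simp: Units_def ring_mat_def)
  have symK: "transpose_mat ?K = ?K" using transpose_mult[OF T G] by simp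
  have TH: "transpose_mat H \<in> carrier_mat k k" using H by simp
  \<comment> \<open>As \<open>?K\<close> is symmetric, transposing
    \<open>?K * H = 1\<^sub>m k\<close> yields a second left inverse, which must be
    \<open>H\<close>. The symmetry of \<open>H\<close> gives the symmetry of \<open>G * ?X\<close>
    below.\<close>
  have "transpose_mat H * ?K = 1\<^sub>m k"
    using transpose_mult[OF K H(1)] H(3) symK by simp
  then have symH: "transpose_mat H = H"
    using assoc_mult_mat[OF TH K H(1)] H TH by simp
  let ?X = "H * ?T"
  have X: "?X \<in> carrier_mat k l" using H T by auto
  have XG: "?X * G = 1\<^sub>m k" using assoc_mult_mat[OF H(1) T G] H(2) by simp
  have "transpose_mat (G * ?X) = transpose_mat ?X * ?T" by (rule transpose_mult[OF G X])
  also have "transpose_mat ?X = G * H" using transpose_mult[OF H(1) T] symH by simp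
  also have "G * H * ?T = G * ?X" by (rule assoc_mult_mat[OF G H(1) T])
  finally have symGX: "transpose_mat (G * ?X) = G * ?X" .
  have "G * ?X * G = G" using assoc_mult_mat[OF G X G] XG G by simp
  moreover have "?X * G * ?X = ?X" unfolding XG by (rule left_mult_one_mat[OF X])
  moreover have "?X \<in> carrier_mat (dim_col G) (dim_row G)" using X G by simp
  moreover have "transpose_mat (?X * G) = ?X * G" unfolding XG by simp
  ultimately have "is_pseudo_inverse G ?X"
    using symGX unfolding is_pseudo_inverse_def by blast
  then show "is_pseudo_inverse G (pseudo_inverse G)" "pseudo_inverse G * G = 1\<^sub>m k"
    using pseudo_inverse_eqI XG by auto
qed

section \<open>Full column rank and coordinates on the null space\<close>

text \<open>Independence concerns the set of columns, so repetitions are excluded first: a maximal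
  independent subset has as many elements as the rank \<open>k\<close>, which forces the
  \<open>k\<close> columns to be distinct. A nonzero kernel vector would then be a linear dependence
  among them.\<close>

lemma full_column_rank_trivial_kernel:
  fixes G :: "'a :: field mat"
  assumes G: "G \<in> carrier_mat l k" and rank: "vec_space.rank l G = k"
    and w: "w \<in> carrier_vec k" "G *\<^sub>v w = 0\<^sub>v l"
  shows "w = 0\<^sub>v k"
proof -
  interpret vec_space "TYPE('a)" l .
  obtain S where S: "maximal S (\<lambda>T. T \<subseteq> set (cols G) \<and> lin_indpt T)"
    using maximal_exists_superset[of "set (cols G)" "\<lambda>T. T \<subseteq> set (cols G) \<and> lin_indpt T" "{}"]
    by (auto simp: lin_dep_def)
  then have "card S \<le> card (set (cols G))" by (intro card_mono) (auto simp: maximal_def)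
  then have "k \<le> card (set (cols G))" using rank_card_indpt[OF G S] rank by simp
  moreover have "card (set (cols G)) \<le> k" using card_length[of "cols G"] G by simp
  ultimately have dist: "distinct (cols G)" using G by (intro card_distinct) simp
  then have "lin_indpt (set (cols G))" using full_rank_lin_indpt[OF G rank] by simp
  then show ?thesis using lin_depI[OF G w(1) _ w(2) dist] by blast
qed

text \<open>Provides coordinates \<open>w\<close> for the difference of two feasible points: the
  columns span the null space, and a combination of distinct columns is a matrix-vector
  product.\<close>

lemma cols_basis_of_kernel_surj:
  assumes M: "M \<in> carrier_mat m d" and B: "B \<in> carrier_mat d k"
    and basis: "cols_basis_of_kernel B M"
    and z: "z \<in> carrier_vec d" "M *\<^sub>v z = 0\<^sub>v m"
  obtains w where "w \<in> carrier_vec k" "z = B *\<^sub>v w"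
proof -
  interpret kernel m d M by unfold_locales (rule M)
  have dist: "distinct (cols B)" and bas: "basis (set (cols B))"
    using basis M by (auto simp: cols_basis_of_kernel_def)
  have sub: "set (cols B) \<subseteq> mat_kernel M" and sp: "span (set (cols B)) = mat_kernel M"
    using bas by (auto simp: Ker.basis_def)
  \<comment> \<open>The basis property uses the span inside the null space as a vector space of its
    own; \<open>span_same\<close> passes to the ambient space, where combinations of columns are
    matrix products.\<close>
  have "z \<in> NC.span (set (cols B))"
    using span_same[OF sub] sp z M by (auto simp: mat_kernel)
  then obtain a where "z = NC.lincomb a (set (cols B))"
    using NC.finite_in_span[of "set (cols B)" z] sub mat_kernel_carrier[OF M] by auto
  then have "z = B *\<^sub>v vec k (\<lambda>i. a (col B i))"
    using NC.mat_mult_eq_lincomb[OF B dist] by simp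
  then show ?thesis by (intro that) auto
qed

section \<open>The recovery condition and the uniqueness of the minimizer\<close>

text \<open>Sign vectors lie in the unit ball of the maximum norm, so the operator norm bounds every
  value. Boundedness allows a single value to be compared with the real supremum.\<close>

lemma bdd_above_recovery:
  assumes A: "A \<in> carrier_mat n k" and C: "C \<in> carrier_mat k d" and S: "S \<subseteq> carrier_vec d"
  shows "bdd_above ((\<lambda>x. linf_norm (A *\<^sub>v sign_vec (C *\<^sub>v x))) ` S)"
proof (rule bdd_aboveI2)
  fix x assume "x \<in> S"
  then have "sign_vec (C *\<^sub>v x) \<in> carrier_vec k"
    using C S by (intro sign_vec_carrier) auto
  then show "linf_norm (A *\<^sub>v sign_vec (C *\<^sub>v x)) \<le> op_norm linf_norm A"
    by (rule linf_norm_mult_vec_le_op_norm[OF A _ linf_norm_sign_vec_le])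
qed

theorem corollary8:
  fixes m d p l :: nat and M \<Omega> N :: "real mat" and \<Lambda> :: "nat set"
  assumes "m < d"
    and "M \<in> carrier_mat m d"
    and "lin_indpt_rows M"
    and "\<Omega> \<in> carrier_mat p d"
    and "transpose_mat N \<in> carrier_mat d (d - m)"
    and "cols_basis_of_kernel (transpose_mat N) M"
    and "\<Lambda> \<subseteq> {..<p}"
    and "card \<Lambda> = l"
    and "\<exists>x\<in>carrier_vec d. cosupport \<Omega> x = \<Lambda>"
    and "vec_space.rank l (row_submatrix \<Omega> \<Lambda> * transpose_mat N) = d - m"
  shows "(recovery_condition \<Omega> N \<Lambda> \<longrightarrow>
           (\<forall>x0\<in>carrier_vec d. cosupport \<Omega> x0 = \<Lambda> \<longrightarrow>
              unique_minimizer (\<lambda>x. l1_norm (\<Omega> *\<^sub>v x))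
                (\<lambda>x. x \<in> carrier_vec d \<and> M *\<^sub>v x = M *\<^sub>v x0) x0))
       \<and> (let \<Omega>\<^sub>L = row_submatrix \<Omega> \<Lambda>; \<Omega>\<^sub>C = row_submatrix \<Omega> ({..<p} - \<Lambda>);
              A = pseudo_inverse (N * transpose_mat \<Omega>\<^sub>L) * (N * transpose_mat \<Omega>\<^sub>C);
              B = (\<Omega>\<^sub>C * transpose_mat N) * pseudo_inverse (\<Omega>\<^sub>L * transpose_mat N)
          in op_norm linf_norm A = op_norm l1_norm B
           \<and> (op_norm linf_norm A < 1 \<longrightarrow> recovery_condition \<Omega> N \<Lambda>))"
proof -
  let ?k = "d - m"
  let ?L = "row_submatrix \<Omega> \<Lambda>"
  let ?C = "row_submatrix \<Omega> ({..<p} - \<Lambda>)"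
  let ?T = "transpose_mat N"
  let ?G = "?L * ?T"
  let ?P = "pseudo_inverse ?G"
  let ?A = "pseudo_inverse (N * transpose_mat ?L) * (N * transpose_mat ?C)"
  let ?B = "(?C * ?T) * ?P"
  define c where "c = card ({..<p} - \<Lambda>)"
  note M = assms(2) and Om = assms(4) and T = assms(5) and sub = assms(7)
  have N: "N \<in> carrier_mat ?k d" using T by simp
  have L: "?L \<in> carrier_mat l d" using row_submatrix_carrier[OF Om sub] assms(8) by simp
  have C: "?C \<in> carrier_mat c d" using row_submatrix_carrier[OF Om Diff_subset] c_def by simp
  have G: "?G \<in> carrier_mat l ?k" and CT: "?C * ?T \<in> carrier_mat c ?k" using L C T by auto
  have inj: "w = 0\<^sub>v ?k" if "w \<in> carrier_vec ?k" "?G *\<^sub>v w = 0\<^sub>v l" for w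
    using full_column_rank_trivial_kernel[OF G assms(10) that] .
  note pinv = pseudo_inverse_trivial_kernel[OF G inj]
  have P: "?P \<in> carrier_mat ?k l" 
    using pinv(1) unfolding is_pseudo_inverse_def carrier_matD[OF G] by blast
  \<comment> \<open>Both factors of \<open>?A\<close> are transposes of factors of
    \<open>?B\<close>, so that \<open>?A\<close> is the transpose of \<open>?B\<close>.\<close>
  have "transpose_mat ?G = N * transpose_mat ?L" using transpose_mult[OF L T] by simp
  then have pinvT: "pseudo_inverse (N * transpose_mat ?L) = transpose_mat ?P"
    using pseudo_inverse_eqI[OF is_pseudo_inverse_transpose[OF pinv(1)]] by simp
  have "transpose_mat (?C * ?T) = N * transpose_mat ?C" using transpose_mult[OF C T] by simp
  then have A_eq: "?A = transpose_mat ?B"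
    unfolding pinvT using transpose_mult[OF CT P] by simp
  have B: "?B \<in> carrier_mat c l" using CT P by auto
  have A: "?A \<in> carrier_mat l c" unfolding A_eq using B by simp
  have norms: "op_norm linf_norm ?A = op_norm l1_norm ?B"
    using op_norm_linf_eq_op_norm_l1_transpose[OF A] A_eq by simp
  let ?S = "{x \<in> carrier_vec d. ?L *\<^sub>v x = 0\<^sub>v l}"
  have rc: "recovery_condition \<Omega> N \<Lambda> \<longleftrightarrow>
      (SUP x\<in>?S. linf_norm (?A *\<^sub>v sign_vec (?C *\<^sub>v x))) < 1"
    unfolding recovery_condition_def Let_def using Om L by simp

  have suff: "recovery_condition \<Omega> N \<Lambda>" if "op_norm linf_norm ?A < 1"
  proof -
    have "(SUP x\<in>?S. linf_norm (?A *\<^sub>v sign_vec (?C *\<^sub>v x))) \<le> op_norm linf_norm ?A"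
    proof (rule cSUP_least)
      show "?S \<noteq> {}" using L by (auto intro!: exI[of _ "0\<^sub>v d"])
      fix x assume "x \<in> ?S"
      then have "sign_vec (?C *\<^sub>v x) \<in> carrier_vec c" using C by (intro sign_vec_carrier) auto
      then show "linf_norm (?A *\<^sub>v sign_vec (?C *\<^sub>v x)) \<le> op_norm linf_norm ?A"
        by (rule linf_norm_mult_vec_le_op_norm[OF A _ linf_norm_sign_vec_le])
    qed
    then show ?thesis using that rc by simp
  qed

  have uniq: "unique_minimizer (\<lambda>x. l1_norm (\<Omega> *\<^sub>v x))
      (\<lambda>x. x \<in> carrier_vec d \<and> M *\<^sub>v x = M *\<^sub>v x0) x0"
    if cond: "recovery_condition \<Omega> N \<Lambda>" and x0: "x0 \<in> carrier_vec d" and cosp: "cosupport \<Omega> x0 = \<Lambda>"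
    for x0
  proof -
    have L0: "?L *\<^sub>v x0 = 0\<^sub>v l" using row_submatrix_cosupport[OF Om, of x0] cosp assms(8) by simp
    let ?s = "sign_vec (?C *\<^sub>v x0)"
    let ?q = "?A *\<^sub>v ?s"
    have Cx0: "?C *\<^sub>v x0 \<in> carrier_vec c" using C x0 by auto
    have s: "?s \<in> carrier_vec c" by (rule sign_vec_carrier[OF Cx0])
    have q: "?q \<in> carrier_vec l" using A s by auto
    \<comment> \<open>\<open>x0\<close> is itself admissible in the supremum, because
      \<open>?L\<close> annihilates it.\<close>
    have "linf_norm ?q \<le> (SUP x\<in>?S. linf_norm (?A *\<^sub>v sign_vec (?C *\<^sub>v x)))"
      using x0 L0 by (intro cSUP_upper bdd_above_recovery[OF A C]) auto
    then have q1: "linf_norm ?q < 1" using cond rc by simp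
    have less: "l1_norm (\<Omega> *\<^sub>v x0) < l1_norm (\<Omega> *\<^sub>v y)"
      if y: "y \<in> carrier_vec d" "M *\<^sub>v y = M *\<^sub>v x0" "y \<noteq> x0" for y
    proof -
      let ?z = "y - x0"
      have z: "?z \<in> carrier_vec d" using y x0 by auto
      have yz: "y = x0 + ?z" using y(1) x0 by auto
      have "M *\<^sub>v ?z = M *\<^sub>v y - M *\<^sub>v x0" by (rule mult_minus_distrib_mat_vec[OF M y(1) x0])
      also have "\<dots> = 0\<^sub>v m" using y(2) M x0 by simp
      finally obtain w where w: "w \<in> carrier_vec ?k" "?z = ?T *\<^sub>v w"
        using cols_basis_of_kernel_surj[OF M T assms(6) z] by blast
      have Lz: "?L *\<^sub>v ?z = ?G *\<^sub>v w" and Cz: "?C *\<^sub>v ?z = (?C * ?T) *\<^sub>v w"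
        using w assoc_mult_mat_vec[OF L T w(1)] assoc_mult_mat_vec[OF C T w(1)] by auto
      have Lzc: "?L *\<^sub>v ?z \<in> carrier_vec l" and Czc: "?C *\<^sub>v ?z \<in> carrier_vec c" using L C z by auto
      \<comment> \<open>Strictness originates here: \<open>y\<close> differs from \<open>x0\<close>,
        so \<open>w\<close> is nonzero, and injectivity of \<open>?G\<close> makes
        \<open>?L *\<^sub>v ?z\<close> nonzero.\<close>
      have "?z \<noteq> 0\<^sub>v d" using yz y(3) x0 by auto
      then have "w \<noteq> 0\<^sub>v ?k" using w T by auto
      then have pos: "0 < l1_norm (?L *\<^sub>v ?z)"
        using l1_norm_pos[OF Lzc] inj[OF w(1)] Lz by auto
      \<comment> \<open>The left inverse \<open>?P\<close> recovers \<open>w\<close> from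
        \<open>?L *\<^sub>v ?z\<close>, so the entries off \<Lambda> are determined by those on
        \<Lambda>.\<close>
      have "?B *\<^sub>v (?L *\<^sub>v ?z) = (?C * ?T) *\<^sub>v (?P *\<^sub>v (?G *\<^sub>v w))"
        unfolding Lz using assoc_mult_mat_vec[OF CT P, of "?G *\<^sub>v w"] G w by auto
      also have "?P *\<^sub>v (?G *\<^sub>v w) = w"
        using assoc_mult_mat_vec[OF P G w(1)] pinv(2) w by simp
      finally have "?C *\<^sub>v ?z = ?B *\<^sub>v (?L *\<^sub>v ?z)" using Cz by simp
      then have "?s \<bullet> (?C *\<^sub>v ?z) = ?q \<bullet> (?L *\<^sub>v ?z)"
        unfolding A_eq using transpose_vec_mult_scalar[OF B Lzc s] by simp
      then have dual: "\<bar>?s \<bullet> (?C *\<^sub>v ?z)\<bar> < l1_norm (?L *\<^sub>v ?z)"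
        using holder_l1_linf[OF q Lzc] mult_strict_right_mono[OF q1 pos] by simp
      have Ly: "?L *\<^sub>v y = ?L *\<^sub>v ?z"
        using mult_add_distrib_mat_vec[OF L x0 z] yz L0 Lzc by simp
      have Cy: "?C *\<^sub>v y = ?C *\<^sub>v x0 + ?C *\<^sub>v ?z"
        using mult_add_distrib_mat_vec[OF C x0 z] yz by simp
      \<comment> \<open>The subgradient inequality for the l1-norm at
        \<open>?C *\<^sub>v x0\<close>.\<close>
      have "l1_norm (?C *\<^sub>v x0) + ?s \<bullet> (?C *\<^sub>v ?z) = ?s \<bullet> (?C *\<^sub>v y)"
        unfolding Cy scalar_prod_add_distrib[OF s Cx0 Czc] sign_vec_scalar_prod_self ..
      also have "\<dots> \<le> l1_norm (?C *\<^sub>v y)"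
        using sign_vec_scalar_prod_le[OF Cx0, of "?C *\<^sub>v y"] C y by auto
      finally have "l1_norm (?C *\<^sub>v x0) < l1_norm (?L *\<^sub>v y) + l1_norm (?C *\<^sub>v y)"
        using dual Ly by simp
      \<comment> \<open>The rows in \<Lambda> contribute nothing at \<open>x0\<close>, so its full
        norm is \<open>l1_norm (?C *\<^sub>v x0)\<close>.\<close>
      then show ?thesis
        using l1_norm_split_rows[OF Om sub, of x0] l1_norm_split_rows[OF Om sub, of y] L0
        by (simp add: l1_norm_def)
    qed
    show ?thesis
      unfolding unique_minimizer_def is_arg_min_def
      using less x0 by (metis less_asym)
  qed
  show ?thesis using norms suff uniq by (simp add: Let_def)
qed

end
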